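(* Let $k,t$ be integers with $k=t^2\ge 4$, and let $H$ be a subgraph of the star $K_{1,k-1}$ with $|E(H)|\ge 3$. Then $$\operatorname{bi-GM}_{k-1}(P_4:H)=t^2(t-1)^2-2(t-1).$$
   Context: All graphs are finite, simple and without isolated vertices. $P_n$ is the path on $n$ vertices; $K_{m,n}$ is the complete bipartite graph. A $k$-edge-coloring of a graph is a map from its edge set onto $\{1,\dots,k\}$ that is exact, i.e. every one of the $k$ colors is used at least once. An edge-colored graph is rainbow if all its edges have distinct colors and monochromatic if all its edges have the same color. A copy of a graph $F$ in a graph $G$ is a subgraph of $G$ isomorphic to $F$; distinct copies are distinct subgraphs. For non-empty bipartite graphs $G,H$ and a positive integer $k$, the bipartite Gallai-Ramsey number $\operatorname{bgr}_k(G:H)$ is the minimum integer $N$ such that for all $n\ge N$, every (exact) $k$-edge-coloring of $K_{n,n}$ contains a rainbow copy of $G$ or a monochromatic copy of $H$. The bipartite Gallai-Ramsey multiplicity $\operatorname{bi-GM}_k(G:H)$ is the minimum, over all (exact) $k$-edge-colorings of $K_{N,N}$ with $N=\operatorname{bgr}_k(G:H)$, of the total number of rainbow copies of $G$ plus monochromatic copies of $H$.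
   Formalization: t is taken non-negative (the formula fails for negative t, e.g. t=-2), and bgr_k is the minimum over those N for which K_{N,N} has an exact k-edge-coloring, since otherwise small N qualify vacuously and bi-GM would be a minimum over the empty set. *)

theory Defs
  imports Main
begin

record 'a ugraph =
  verts :: "'a set"
  edges :: "'a set set"

text \<open>Finite simple graphs; following the standing convention, isolated vertices are excluded.\<close>
definition simple_graph :: "'a ugraph \<Rightarrow> bool" where
  "simple_graph G \<longleftrightarrow>
     finite (verts G) \<and>
     (\<forall>e\<in>edges G. e \<subseteq> verts G \<and> card e = 2) \<and>
     (\<forall>v\<in>verts G. \<exists>e\<in>edges G. v \<in> e)"

definition subgraph :: "'a ugraph \<Rightarrow> 'a ugraph \<Rightarrow> bool" where
  "subgraph S G \<longleftrightarrow> simple_graph S \<and> verts S \<subseteq> verts G \<and> edges S \<subseteq> edges G"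

definition graph_iso :: "'a ugraph \<Rightarrow> 'b ugraph \<Rightarrow> bool" where
  "graph_iso G H \<longleftrightarrow>
     (\<exists>f. bij_betw f (verts G) (verts H) \<and> edges H = (\<lambda>e. f ` e) ` edges G)"

definition copies :: "'b ugraph \<Rightarrow> 'a ugraph \<Rightarrow> 'a ugraph set" where
  "copies F G = {S. subgraph S G \<and> graph_iso S F}"

definition path_graph :: "nat \<Rightarrow> nat ugraph" where
  "path_graph n = \<lparr>verts = {..<n}, edges = {{i, Suc i} | i. Suc i < n}\<rparr>"

definition complete_bipartite :: "nat \<Rightarrow> nat \<Rightarrow> (nat + nat) ugraph" where
  "complete_bipartite m n =
     \<lparr>verts = Inl ` {..<m} \<union> Inr ` {..<n}, edges = {{Inl i, Inr j} | i j. i < m \<and> j < n}\<rparr>"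

text \<open>A colouring is a total function on vertex sets, of which only the values on edges matter.\<close>
definition exact_coloring :: "nat \<Rightarrow> 'a ugraph \<Rightarrow> ('a set \<Rightarrow> nat) \<Rightarrow> bool" where
  "exact_coloring k G c \<longleftrightarrow> c ` edges G = {1..k}"

definition rainbow :: "('a set \<Rightarrow> nat) \<Rightarrow> 'a ugraph \<Rightarrow> bool" where
  "rainbow c F \<longleftrightarrow> inj_on c (edges F)"

definition monochromatic :: "('a set \<Rightarrow> nat) \<Rightarrow> 'a ugraph \<Rightarrow> bool" where
  "monochromatic c F \<longleftrightarrow> (\<exists>i. \<forall>e\<in>edges F. c e = i)"

text \<open>The first conjunct restricts the minimum to those \<open>N\<close> for which \<open>K\<^bsub>N,N\<^esub>\<close> has an exact
  \<open>k\<close>-edge-colouring at all (for \<open>k \<ge> 1\<close>: \<open>k \<le> N\<^sup>2\<close>). Without it, small \<open>N\<close> satisfy the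
  Ramsey condition vacuously, and the minimum defining the multiplicity could range over the
  empty set.\<close>
definition bgr :: "nat \<Rightarrow> 'a ugraph \<Rightarrow> 'b ugraph \<Rightarrow> nat" where
  "bgr k G H = (LEAST N.
     (\<exists>c. exact_coloring k (complete_bipartite N N) c) \<and>
     (\<forall>n\<ge>N. \<forall>c. exact_coloring k (complete_bipartite n n) c \<longrightarrow>
        (\<exists>S\<in>copies G (complete_bipartite n n). rainbow c S) \<or>
        (\<exists>S\<in>copies H (complete_bipartite n n). monochromatic c S)))"

definition num_copies ::
  "'a ugraph \<Rightarrow> 'b ugraph \<Rightarrow> 'c ugraph \<Rightarrow> ('c set \<Rightarrow> nat) \<Rightarrow> nat" where
  "num_copies G H K c =
     card {S \<in> copies G K. rainbow c S} + card {S \<in> copies H K. monochromatic c S}"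

definition bi_GM :: "nat \<Rightarrow> 'a ugraph \<Rightarrow> 'b ugraph \<Rightarrow> nat" where
  "bi_GM k G H = (let K = complete_bipartite (bgr k G H) (bgr k G H) in
     (LEAST m. \<exists>c. exact_coloring k K c \<and> m = num_copies G H K c))"

end

theory Submission imports Defs begin

text \<open>If a coloring of a complete bipartite graph has at least three colors and no rainbow
  \<open>P\<^sub>4\<close>, then all vertices on one side see a single color each. With \<open>t\<^sup>2 - 1\<close> colors this
  forces the side to have at least \<open>t\<^sup>2 - 1\<close> vertices, hence a monochromatic \<open>K\<^bsub>1,k-1\<^esub>\<close>; so the
  Ramsey number is \<open>t\<close>, the least size that has enough edges. On \<open>K\<^bsub>t,t\<^esub>\<close> a coloring with
  \<open>t\<^sup>2 - 1\<close> colors repeats exactly one color, on exactly two edges, so no copy of \<open>H\<close> is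
  monochromatic and a \<open>P\<^sub>4\<close> fails to be rainbow iff it contains both of these edges. There are
  \<open>t\<^sup>2(t-1)\<^sup>2\<close> paths \<open>P\<^sub>4\<close>; of these \<open>2(t-1)\<close> contain two given adjacent edges, and only \<open>2\<close>
  contain two given disjoint edges.\<close>

section \<open>Colorings without a rainbow path on four vertices\<close>

text \<open>Edges are split into the arguments of \<open>c\<close>, and \<open>three\<close> says
  that no two colors suffice. If some \<open>u\<close> sees two colors, a third color is forced at
  \<open>u\<close> as well; then the color at each \<open>v\<close> is dictated by \<open>u\<close>,
  so every vertex of \<open>V\<close> is single-colored.\<close>

lemma no_rainbow_P4_one_side_mono:
  assumes norb: "\<And>u u' v v'. \<lbrakk>u \<in> U; u' \<in> U; v \<in> V; v' \<in> V; u \<noteq> u'; v \<noteq> v'\<rbrakk>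
      \<Longrightarrow> \<not> distinct [c u v, c u' v, c u' v']"
    and three: "\<And>a b. \<exists>u\<in>U. \<exists>v\<in>V. c u v \<noteq> a \<and> c u v \<noteq> b"
  shows "(\<forall>u\<in>U. \<exists>i. \<forall>v\<in>V. c u v = i) \<or> (\<forall>v\<in>V. \<exists>i. \<forall>u\<in>U. c u v = i)"
proof (subst disj_imp, rule impI)
  assume "\<not> (\<forall>u\<in>U. \<exists>i. \<forall>v\<in>V. c u v = i)"
  then obtain u v1 v2 where u: "u \<in> U" and v12: "v1 \<in> V" "v2 \<in> V" "c u v1 \<noteq> c u v2"
    by metis
  obtain x y where xy: "x \<in> U" "y \<in> V" "c x y \<noteq> c u v1" "c x y \<noteq> c u v2"
    using three by metis
  \<comment> \<open>The third color, found on \<open>x y\<close>, is pulled over to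
    \<open>u\<close>: the paths \<open>x - y - u - v1\<close> and \<open>x - y - u - v2\<close> are
    not rainbow, which leaves only \<open>c u y = c x y\<close>.\<close>
  have "c u y \<noteq> c u v1 \<and> c u y \<noteq> c u v2"
  proof (cases "x = u")
    case False
    have "y \<noteq> v1" "y \<noteq> v2"
      using norb[of x u v1 v2] norb[of x u v2 v1] u v12 xy False by auto
    then show ?thesis
      using norb[of x u y v1] norb[of x u y v2] u v12 xy False by auto
  qed (use xy in auto)
  then have y: "c u y \<noteq> c u v1" "c u y \<noteq> c u v2" by auto
  have "c x' v = c u v" if x'v: "x' \<in> U" "v \<in> V" for x' v
  proof (cases "x' = u")
    case False
    \<comment> \<open>This comes from the path \<open>x' - v - u - w\<close>. As \<open>u\<close>
      sees three colors, two choices of \<open>w\<close> with different colors rule out the second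
      alternative.\<close>
    have two: "c x' v = c u v \<or> c x' v = c u w" if "w \<in> V" "c u w \<noteq> c u v" for w
      using norb[of x' u v w] u x'v that False by auto
    obtain w w' where "w \<in> V" "w' \<in> V" "c u w \<noteq> c u v" "c u w' \<noteq> c u v" "c u w \<noteq> c u w'"
      using v12 xy(2) y by metis
    with two[of w] two[of w'] show ?thesis by auto
  qed simp
  then show "\<forall>v\<in>V. \<exists>i. \<forall>u\<in>U. c u v = i" by blast
qed

section \<open>Graph isomorphisms and copies\<close>

lemma graph_iso_sym:
  assumes "simple_graph G" "graph_iso G H"
  shows "graph_iso H G"
proof -
  obtain f where f: "bij_betw f (verts G) (verts H)" "edges H = (\<lambda>e. f ` e) ` edges G"
    using assms(2) by (auto simp: graph_iso_def)
  let ?g = "inv_into (verts G) f"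
  have "?g ` f ` e = e" if "e \<in> edges G" for e
    using that assms(1) f(1)
    by (intro inv_into_image_cancel) (auto simp: simple_graph_def bij_betw_def)
  then have "edges G = (\<lambda>e. ?g ` e) ` edges H"
    by (auto simp: f(2) image_image)
  then show ?thesis
    using bij_betw_inv_into[OF f(1)] unfolding graph_iso_def by blast
qed

lemma graph_iso_trans:
  assumes "graph_iso G H" "graph_iso H K"
  shows "graph_iso G K"
proof -
  obtain f g where "bij_betw f (verts G) (verts H)" "edges H = (\<lambda>e. f ` e) ` edges G"
    "bij_betw g (verts H) (verts K)" "edges K = (\<lambda>e. g ` e) ` edges H"
    using assms by (auto simp: graph_iso_def)
  then show ?thesis
    unfolding graph_iso_def
    by (intro exI[of _ "g \<circ> f"]) (auto simp: bij_betw_trans image_comp image_image)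
qed

text \<open>Pushes a copy forward along an embedding \<open>g\<close> of the host graph. It serves
  to move a copy of \<open>H\<close> from an abstract star onto a monochromatic star of the colored
  graph.\<close>

lemma mono_copy_embed:
  assumes S: "subgraph S K" "graph_iso S H"
    and g: "inj_on g (verts K)" "g ` verts K \<subseteq> verts L" "\<And>e. e \<in> edges K \<Longrightarrow> g ` e \<in> edges L"
    and mono: "\<And>e. e \<in> edges K \<Longrightarrow> c (g ` e) = a"
  shows "\<exists>S\<in>copies H L. monochromatic c S"
proof -
  let ?S' = "\<lparr>verts = g ` verts S, edges = (\<lambda>e. g ` e) ` edges S\<rparr>"
  have inj: "inj_on g (verts S)" and simp: "simple_graph S"
    using S g(1) by (auto simp: subgraph_def intro: inj_on_subset)
  have "card (g ` e) = 2" "e \<subseteq> verts S" if "e \<in> edges S" for e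
    using that simp inj by (auto simp: simple_graph_def card_image inj_on_subset)
  then have "simple_graph ?S'"
    using simp by (fastforce simp: simple_graph_def)
  then have "subgraph ?S' L"
    using S(1) g by (auto simp: subgraph_def)
  moreover have "graph_iso S ?S'"
    using inj by (auto simp: graph_iso_def bij_betw_def)
  ultimately have "?S' \<in> copies H L"
    using graph_iso_trans[OF graph_iso_sym[OF _ \<open>graph_iso S ?S'\<close>] S(2)] simp
    by (simp add: copies_def)
  moreover have "monochromatic c ?S'"
    using mono S(1) unfolding monochromatic_def
    by (intro exI[of _ a]) (auto simp: subgraph_def)
  ultimately show ?thesis ..
qed

lemma card_edges_copy:
  assumes "S \<in> copies H K" "finite (edges K)"
  shows "card (edges H) \<le> card (edges S)"
proof -
  have "finite (edges S)"
    using assms by (auto simp: copies_def subgraph_def intro: finite_subset)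
  then show ?thesis
    using assms(1) by (auto simp: copies_def graph_iso_def intro: card_image_le)
qed

section \<open>Paths on four vertices in a complete bipartite graph\<close>

text \<open>Edges are handled as pairs of a left and a right index, so that counting takes place in
  products of sets of numbers.\<close>

definition bedge :: "nat \<times> nat \<Rightarrow> (nat + nat) set" where
  "bedge p = {Inl (fst p), Inr (snd p)}"

text \<open>The quadruple stands for the path \<open>a - b - a' - b'\<close>. A path on four
  vertices has exactly one end on each side, so reading it from its left end makes the encoding
  unique.\<close>

definition path_edges :: "(nat \<times> nat) \<times> (nat \<times> nat) \<Rightarrow> (nat \<times> nat) set" where
  "path_edges = (\<lambda>((a, a'), (b, b')). {(a, b), (a', b), (a', b')})"

definition path4 :: "(nat \<times> nat) \<times> (nat \<times> nat) \<Rightarrow> (nat + nat) ugraph" where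
  "path4 q = \<lparr>verts = {Inl (fst (fst q)), Inl (snd (fst q)), Inr (fst (snd q)), Inr (snd (snd q))},
     edges = bedge ` path_edges q\<rparr>"

definition offdiag :: "nat \<Rightarrow> (nat \<times> nat) set" where
  "offdiag n = {(a, b). a < n \<and> b < n \<and> a \<noteq> b}"

lemma inj_bedge: "inj bedge"
  by (auto simp: inj_on_def bedge_def doubleton_eq_iff)

lemma bedge_eq_iff [simp]: "bedge p = bedge q \<longleftrightarrow> p = q"
  using inj_bedge by (auto dest: injD)

lemma edges_complete_bipartite:
  "edges (complete_bipartite m n) = bedge ` ({..<m} \<times> {..<n})"
  by (auto simp: complete_bipartite_def bedge_def image_def)

lemma card_edges_complete_bipartite: "card (edges (complete_bipartite m n)) = m * n"
  by (simp add: edges_complete_bipartite card_image inj_on_subset[OF inj_bedge])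

lemma finite_edges_complete_bipartite [simp]: "finite (edges (complete_bipartite m n))"
  by (simp add: edges_complete_bipartite)

lemma card_offdiag: "card (offdiag n) = n * (n - 1)"
proof -
  have "offdiag n = (SIGMA a:{..<n}. {..<n} - {a})"
    by (auto simp: offdiag_def)
  then show ?thesis by simp
qed

lemma finite_offdiag [simp]: "finite (offdiag n)"
  by (rule finite_subset[of _ "{..<n} \<times> {..<n}"]) (auto simp: offdiag_def)

text \<open>The edges alone determine the quadruple: \<open>a'\<close> and \<open>b\<close> are the
  vertices of degree two on their sides, \<open>a\<close> and \<open>b'\<close> the ends.\<close>

lemma inj_on_path4: "inj_on path4 (offdiag n \<times> offdiag n)"
proof (rule inj_onI)
  fix p q assume pq: "p \<in> offdiag n \<times> offdiag n" "q \<in> offdiag n \<times> offdiag n" "path4 p = path4 q"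
  then have "path_edges p = path_edges q"
    using inj_image_eq_iff[OF inj_bedge] by (auto simp: path4_def)
  with pq(1,2) show "p = q"
    by (auto simp: path_edges_def offdiag_def set_eq_iff) metis+
qed

lemma edges_path_graph_4: "edges (path_graph 4) = {{0, 1}, {1, 2}, {2, 3}}"
proof -
  have "Suc i < 4 \<longleftrightarrow> i = 0 \<or> i = 1 \<or> i = 2" for i by auto
  then show ?thesis by (auto simp: path_graph_def numeral_eq_Suc)
qed

lemma verts_path_graph_4: "verts (path_graph 4) = {0, 1, 2, 3}"
  by (auto simp: path_graph_def)

lemma path4_copy:
  assumes "q \<in> offdiag n \<times> offdiag n"
  shows "path4 q \<in> copies (path_graph 4) (complete_bipartite n n)"
proof -
  obtain a a' b b' where q: "q = ((a, a'), (b, b'))" by (metis surj_pair)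
  have ab: "a < n" "a' < n" "a \<noteq> a'" "b < n" "b' < n" "b \<noteq> b'"
    using assms by (auto simp: q offdiag_def)
  define f :: "nat \<Rightarrow> nat + nat" where
    "f = (\<lambda>i. if i = 0 then Inl a else if i = 1 then Inr b else if i = 2 then Inl a' else Inr b')"
  have path: "edges (path4 q) = {{Inl a, Inr b}, {Inl a', Inr b}, {Inl a', Inr b'}}"
    "verts (path4 q) = {Inl a, Inl a', Inr b, Inr b'}"
    by (auto simp: path4_def path_edges_def bedge_def q)
  have "bij_betw f (verts (path_graph 4)) (verts (path4 q))"
    using ab unfolding path verts_path_graph_4 by (auto simp: bij_betw_def f_def inj_on_def)
  moreover have "edges (path4 q) = (\<lambda>e. f ` e) ` edges (path_graph 4)"
    unfolding path edges_path_graph_4 by (auto simp: f_def)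
  ultimately have "graph_iso (path_graph 4) (path4 q)"
    unfolding graph_iso_def by blast
  moreover have "simple_graph (path_graph 4)"
    by (auto simp: simple_graph_def verts_path_graph_4 edges_path_graph_4)
  moreover have "subgraph (path4 q) (complete_bipartite n n)"
    unfolding subgraph_def simple_graph_def path using ab
    by (auto simp: complete_bipartite_def)
  ultimately show ?thesis
    by (simp add: copies_def graph_iso_sym)
qed

text \<open>Vertices of a copy alternate between the sides, so it can be read off from its left end.
  Together with injectivity this reduces counting copies to counting quadruples.\<close>

lemma copies_path4:
  "copies (path_graph 4) (complete_bipartite n n) = path4 ` (offdiag n \<times> offdiag n)"
proof (intro equalityI subsetI)
  fix S assume "S \<in> copies (path_graph 4) (complete_bipartite n n)"
  then have sub: "subgraph S (complete_bipartite n n)" and "graph_iso (path_graph 4) S"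
    by (auto simp: copies_def subgraph_def intro: graph_iso_sym)
  then obtain g :: "nat \<Rightarrow> nat + nat" where g: "bij_betw g {0, 1, 2, 3} (verts S)"
    "edges S = (\<lambda>e. g ` e) ` {{0, 1}, {1, 2}, {2, 3}}"
    unfolding graph_iso_def verts_path_graph_4 edges_path_graph_4 by blast
  have V: "verts S = {g 0, g 1, g 2, g 3}"
    using g(1) by (auto simp: bij_betw_def)
  have E: "edges S = {{g 0, g 1}, {g 1, g 2}, {g 2, g 3}}"
    by (simp add: g(2))
  have d: "g 0 \<noteq> g 2" "g 1 \<noteq> g 3"
    using g(1) by (auto simp: bij_betw_def inj_on_def)
  have edge: "\<exists>i j. i < n \<and> j < n \<and> (x = Inl i \<and> y = Inr j \<or> x = Inr j \<and> y = Inl i)"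
    if "{x, y} \<in> edges S" for x y
  proof -
    have "{x, y} \<in> edges (complete_bipartite n n)"
      using that sub unfolding subgraph_def by blast
    then show ?thesis
      by (auto simp: complete_bipartite_def doubleton_eq_iff)
  qed
  have "\<exists>q\<in>offdiag n \<times> offdiag n. verts S = verts (path4 q) \<and> edges S = edges (path4 q)"
  proof (cases "g 0")
    case (Inl a)
    then obtain b a' b' where "g 1 = Inr b" "g 2 = Inl a'" "g 3 = Inr b'"
      "a < n" "b < n" "a' < n" "b' < n"
      using edge[of "g 0" "g 1"] edge[of "g 1" "g 2"] edge[of "g 2" "g 3"] E by auto
    with Inl d show ?thesis unfolding V E
      by (intro bexI[of _ "((a, a'), (b, b'))"])
        (auto simp: path4_def path_edges_def bedge_def offdiag_def)
  next
    \<comment> \<open>The isomorphism starts at the right end here, so the path is read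
      backwards.\<close>
    case (Inr b')
    then obtain a' b a where "g 1 = Inl a'" "g 2 = Inr b" "g 3 = Inl a"
      "a < n" "b < n" "a' < n" "b' < n"
      using edge[of "g 0" "g 1"] edge[of "g 1" "g 2"] edge[of "g 2" "g 3"] E by auto
    with Inr d show ?thesis unfolding V E
      by (intro bexI[of _ "((a, a'), (b, b'))"])
        (auto simp: path4_def path_edges_def bedge_def offdiag_def)
  qed
  then obtain q where "q \<in> offdiag n \<times> offdiag n" "S = path4 q"
    using ugraph.equality by fastforce
  then show "S \<in> path4 ` (offdiag n \<times> offdiag n)" by blast
qed (auto intro: path4_copy)

section \<open>Paths through two given edges\<close>

definition paths_through :: "nat \<Rightarrow> nat \<times> nat \<Rightarrow> nat \<times> nat \<Rightarrow> ((nat \<times> nat) \<times> (nat \<times> nat)) set" where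
  "paths_through n e f = {q \<in> offdiag n \<times> offdiag n. e \<in> path_edges q \<and> f \<in> path_edges q}"

text \<open>The shared vertex must be the inner vertex on its side. The factor 2 chooses which of
  the two edges is the middle one, and \<open>n - 1\<close> counts the free end.\<close>

lemma card_paths_through_adjacent:
  assumes "u < n" "v < n" "w < n" "v \<noteq> w"
  shows "card (paths_through n (u, v) (u, w)) = 2 * (n - 1)"
    and "card (paths_through n (v, u) (w, u)) = 2 * (n - 1)"
proof -
  have "paths_through n (u, v) (u, w) = (({..<n} - {u}) \<times> {u}) \<times> {(v, w), (w, v)}"
    using assms by (auto simp: paths_through_def offdiag_def path_edges_def)
  then show "card (paths_through n (u, v) (u, w)) = 2 * (n - 1)"
    using assms by (simp add: card_cartesian_product)
  have "paths_through n (v, u) (w, u) = {(v, w), (w, v)} \<times> ({u} \<times> ({..<n} - {u}))"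
    using assms by (auto simp: paths_through_def offdiag_def path_edges_def)
  then show "card (paths_through n (v, u) (w, u)) = 2 * (n - 1)"
    using assms by (simp add: card_cartesian_product)
qed

lemma card_paths_through_le:
  assumes "e \<in> {..<n} \<times> {..<n}" "f \<in> {..<n} \<times> {..<n}" "e \<noteq> f"
  shows "card (paths_through n e f) \<le> 2 * (n - 1)"
proof -
  obtain u v w x where e: "e = (u, v)" "f = (w, x)" by fastforce
  consider "u = w" "v \<noteq> x" | "u \<noteq> w" "v = x" | "u \<noteq> w" "v \<noteq> x"
    using assms(3) e by auto
  then show ?thesis
  proof cases
    case 1
    then have "card (paths_through n e f) = 2 * (n - 1)"
      unfolding e using assms card_paths_through_adjacent(1)[of u n v x] by (simp add: e)
    then show ?thesis by simp
  next
    case 2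
    then have "card (paths_through n e f) = 2 * (n - 1)"
      unfolding e using assms card_paths_through_adjacent(2)[of v n u w] by (simp add: e)
    then show ?thesis by simp
  next
    case 3
    \<comment> \<open>Disjoint edges can only be the two end edges; the middle edge then joins
      \<open>w\<close> to \<open>v\<close> or \<open>u\<close> to \<open>x\<close>.\<close>
    then have "paths_through n e f \<subseteq> {((u, w), (v, x)), ((w, u), (x, v))}"
      by (auto simp: paths_through_def path_edges_def e)
    then have "card (paths_through n e f) \<le> card {((u, w), (v, x)), ((w, u), (x, v))}"
      by (rule card_mono[rotated]) simp
    also have "\<dots> = 2"
      using 3 by simp
    \<comment> \<open>The distinct indices \<open>u\<close> and \<open>w\<close> below
      \<open>n\<close> force \<open>n \<ge> 2\<close>.\<close>
    also have "2 \<le> 2 * (n - 1)"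
      using assms 3 e by auto
    finally show ?thesis .
  qed
qed

section \<open>Colorings with a single repeated color\<close>

text \<open>All copies counted are rainbow paths, and the non-rainbow ones are exactly those through
  both \<open>e\<close> and \<open>f\<close>. The sum form avoids truncated subtraction.\<close>

lemma num_copies_single_repeat:
  assumes H: "card (edges H) \<ge> 3"
    and e: "e \<in> {..<n} \<times> {..<n}" and f: "f \<in> {..<n} \<times> {..<n}" and "e \<noteq> f"
    and eq: "c (bedge e) = c (bedge f)"
    and inj: "inj_on c (edges (complete_bipartite n n) - {bedge e})"
  shows "num_copies (path_graph 4) H (complete_bipartite n n) c + card (paths_through n e f)
    = (n * (n - 1)) ^ 2"
proof -
  let ?K = "complete_bipartite n n" and ?Q = "offdiag n \<times> offdiag n"
  have "\<not> monochromatic c S" if S: "S \<in> copies H ?K" for S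
  proof
    assume "monochromatic c S"
    then obtain i where i: "c x = i" if "x \<in> edges S" for x
      by (auto simp: monochromatic_def)
    have sub: "edges S \<subseteq> edges ?K"
      using S by (auto simp: copies_def subgraph_def)
    \<comment> \<open>Without \<open>e\<close> the coloring is injective, so a monochromatic copy
      has at most one edge besides \<open>e\<close>, against the three edges of
      \<open>H\<close>.\<close>
    have "inj_on c (edges S - {bedge e})"
      using inj sub by (rule_tac inj_on_subset) auto
    then have "card (edges S - {bedge e}) = card (c ` (edges S - {bedge e}))"
      by (simp add: card_image)
    also have "\<dots> \<le> card {i}"
      using i by (intro card_mono) auto
    finally have "card (edges S - {bedge e}) \<le> 1" by simp
    moreover have "card (edges S) \<ge> 3"
      using card_edges_copy[OF S] H by simp
    ultimately show False
      by (simp add: card_Diff_singleton_if split: if_splits)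
  qed
  then have "{S \<in> copies H ?K. monochromatic c S} = {}" by blast
  then have no_mono: "card {S \<in> copies H ?K. monochromatic c S} = 0"
    by (metis card.empty)
  have key: "c (bedge x) = c (bedge y) \<longleftrightarrow> x = y \<or> {x, y} = {e, f}"
    if "x \<in> {..<n} \<times> {..<n}" "y \<in> {..<n} \<times> {..<n}" for x y
  proof -
    have *: "bedge z \<in> edges ?K - {bedge e}" if "z \<in> {..<n} \<times> {..<n}" "z \<noteq> e" for z
      using that by (auto simp: edges_complete_bipartite)
    then have **: "c (bedge z) = c (bedge z') \<longleftrightarrow> z = z'"
      if "z \<in> {..<n} \<times> {..<n}" "z \<noteq> e" "z' \<in> {..<n} \<times> {..<n}" "z' \<noteq> e" for z z'
      using inj_on_eq_iff[OF inj, of "bedge z" "bedge z'"] that by simp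
    show ?thesis
      \<comment> \<open>When one of \<open>x\<close>, \<open>y\<close> is \<open>e\<close>, it is
        replaced by \<open>f\<close>, which has the same color and falls under the injective
        part.\<close>
      using **[of x y] **[of x f] **[of f y] that f eq \<open>e \<noteq> f\<close>
      by (cases "x = e"; cases "y = e") (auto simp: doubleton_eq_iff)
  qed
  have rb: "rainbow c (path4 q) \<longleftrightarrow> q \<notin> paths_through n e f" if q: "q \<in> ?Q" for q
  proof -
    have sub: "path_edges q \<subseteq> {..<n} \<times> {..<n}"
      using q by (auto simp: path_edges_def offdiag_def)
    have "rainbow c (path4 q) \<longleftrightarrow> inj_on (c \<circ> bedge) (path_edges q)"
      by (simp add: rainbow_def path4_def comp_inj_on_iff[OF inj_on_subset[OF inj_bedge subset_UNIV], symmetric])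
    also have "\<dots> \<longleftrightarrow> \<not> (e \<in> path_edges q \<and> f \<in> path_edges q)"
    proof
      assume "inj_on (c \<circ> bedge) (path_edges q)"
      then show "\<not> (e \<in> path_edges q \<and> f \<in> path_edges q)"
        using eq \<open>e \<noteq> f\<close> by (auto simp: inj_on_def)
    next
      assume "\<not> (e \<in> path_edges q \<and> f \<in> path_edges q)"
      then show "inj_on (c \<circ> bedge) (path_edges q)"
        using key sub by (intro inj_onI) (auto simp: doubleton_eq_iff subset_iff)
    qed
    finally show ?thesis using q by (auto simp: paths_through_def)
  qed
  have "{S \<in> copies (path_graph 4) ?K. rainbow c S} = path4 ` (?Q - paths_through n e f)"
    unfolding copies_path4 using rb by auto
  then have "card {S \<in> copies (path_graph 4) ?K. rainbow c S} = card (?Q - paths_through n e f)"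
    using inj_on_subset[OF inj_on_path4 Diff_subset] by (simp add: card_image)
  moreover have "card (?Q - paths_through n e f) + card (paths_through n e f) = card ?Q"
  proof -
    have "paths_through n e f \<subseteq> ?Q" "finite ?Q"
      by (auto simp: paths_through_def)
    then show ?thesis
      by (metis card_Diff_subset card_mono finite_subset le_add_diff_inverse2)
  qed
  ultimately show ?thesis
    by (simp add: num_copies_def no_mono card_cartesian_product card_offdiag power2_eq_square)
qed

text \<open>Deleting one of two equally colored elements keeps the image, after which domain and
  image have the same size.\<close>

lemma single_repeat:
  assumes "finite A" "card (c ` A) + 1 = card A"
  obtains x y where "x \<in> A" "y \<in> A" "x \<noteq> y" "c x = c y" "inj_on c (A - {x})"
proof -
  have "\<not> inj_on c A"
    using assms by (auto dest: card_image)
  then obtain x y where xy: "x \<in> A" "y \<in> A" "x \<noteq> y" "c x = c y"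
    by (auto simp: inj_on_def)
  have "c ` A = insert (c x) (c ` (A - {x}))"
    using xy(1) by blast
  also have "\<dots> = c ` (A - {x})"
    using xy by (intro insert_absorb) auto
  finally have "inj_on c (A - {x})"
    using assms xy by (intro eq_card_imp_inj_on) auto
  with xy that show thesis by blast
qed

text \<open>All edges but one are colored bijectively, and the last one copies the color of an
  adjacent edge. This coloring shows that exact colorings exist at size \<open>t\<close>, and it is
  also the extremal one for the multiplicity.\<close>

lemma ex_single_repeat_coloring:
  assumes "t \<ge> 2"
  obtains c where "exact_coloring (t ^ 2 - 1) (complete_bipartite t t) c"
    "c (bedge (0, 0)) = c (bedge (0, 1))"
    "inj_on c (edges (complete_bipartite t t) - {bedge (0, 0)})"
proof -
  let ?E = "edges (complete_bipartite t t)" and ?e = "bedge (0, 0)" and ?f = "bedge (0, 1)"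
  have ef: "?e \<in> ?E" "?f \<in> ?E - {?e}"
    using assms by (auto simp: edges_complete_bipartite)
  have "card (?E - {?e}) = card {1..t ^ 2 - 1}"
    using ef by (simp add: card_edges_complete_bipartite power2_eq_square)
  then obtain h where h: "bij_betw h (?E - {?e}) {1..t ^ 2 - 1}"
    by (metis finite_same_card_bij finite_Diff finite_edges_complete_bipartite finite_atLeastAtMost)
  let ?c = "h(?e := h ?f)"
  have "?c ` (?E - {?e}) = {1..t ^ 2 - 1}"
    using h by (auto simp: bij_betw_def)
  moreover have "?c ` ?E = insert (?c ?e) (?c ` (?E - {?e}))"
    using ef(1) by blast
  moreover have "?c ?e \<in> {1..t ^ 2 - 1}"
    using h ef(2) by (auto simp: bij_betw_def)
  ultimately have "exact_coloring (t ^ 2 - 1) (complete_bipartite t t) ?c"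
    by (metis exact_coloring_def insert_absorb)
  moreover have "?c ?e = ?c ?f" by simp
  moreover have "inj_on ?c (?E - {?e})"
    using h by (auto simp: bij_betw_def inj_on_def)
  ultimately show thesis by (rule that)
qed

section \<open>The Ramsey number\<close>

lemma mono_star_copy:
  assumes S: "subgraph S (complete_bipartite 1 m)" "graph_iso S H"
    and "m \<le> n" "i < n"
    and star: "(\<forall>j<n. c (bedge (i, j)) = a) \<or> (\<forall>j<n. c (bedge (j, i)) = a)"
  shows "\<exists>S\<in>copies H (complete_bipartite n n). monochromatic c S"
  using star
proof
  assume star: "\<forall>j<n. c (bedge (i, j)) = a"
  \<comment> \<open>The map is constant on the left, yet injective on the star, whose only left
    vertex is its center.\<close>
  let ?g = "\<lambda>x. case x of Inl _ \<Rightarrow> Inl i | Inr j \<Rightarrow> Inr j"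
  have g: "?g ` bedge (l, j) = bedge (i, j)" for l j
    by (simp add: bedge_def)
  from S show ?thesis
    by (rule mono_copy_embed[where g = ?g and a = a])
      (use \<open>m \<le> n\<close> \<open>i < n\<close> star in
        \<open>auto simp: edges_complete_bipartite g, auto simp: complete_bipartite_def inj_on_def\<close>)
next
  assume star: "\<forall>j<n. c (bedge (j, i)) = a"
  \<comment> \<open>The center now lies on the right, so the two sides are exchanged.\<close>
  let ?g = "\<lambda>x. case x of Inl _ \<Rightarrow> Inr i | Inr j \<Rightarrow> Inl j"
  have g: "?g ` bedge (l, j) = bedge (j, i)" for l j
    by (simp add: bedge_def insert_commute)
  from S show ?thesis
    by (rule mono_copy_embed[where g = ?g and a = a])
      (use \<open>m \<le> n\<close> \<open>i < n\<close> star in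
        \<open>auto simp: edges_complete_bipartite g, auto simp: complete_bipartite_def inj_on_def\<close>)
qed

lemma rainbow_P4_or_mono_star:
  assumes c: "exact_coloring m (complete_bipartite n n) c" and "m \<ge> 3"
    and S: "subgraph S (complete_bipartite 1 m)" "graph_iso S H"
  shows "(\<exists>S\<in>copies (path_graph 4) (complete_bipartite n n). rainbow c S) \<or>
    (\<exists>S\<in>copies H (complete_bipartite n n). monochromatic c S)"
proof (subst disj_imp, rule impI)
  assume norb: "\<not> (\<exists>S\<in>copies (path_graph 4) (complete_bipartite n n). rainbow c S)"
  let ?d = "\<lambda>u v. c (bedge (u, v))"
  have img: "{1..m} = (\<lambda>(u, v). ?d u v) ` ({..<n} \<times> {..<n})"
    using c by (auto simp: exact_coloring_def edges_complete_bipartite image_image)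
  have "(\<forall>u\<in>{..<n}. \<exists>i. \<forall>v\<in>{..<n}. ?d u v = i) \<or> (\<forall>v\<in>{..<n}. \<exists>i. \<forall>u\<in>{..<n}. ?d u v = i)"
  proof (rule no_rainbow_P4_one_side_mono)
    fix u u' v v' assume "u \<in> {..<n}" "u' \<in> {..<n}" "v \<in> {..<n}" "v' \<in> {..<n}" "u \<noteq> u'" "v \<noteq> v'"
    then have "\<not> rainbow c (path4 ((u, u'), (v, v')))"
      using norb path4_copy[of "((u, u'), (v, v'))" n] by (auto simp: offdiag_def)
    then show "\<not> distinct [?d u v, ?d u' v, ?d u' v']"
      by (auto simp: rainbow_def path4_def path_edges_def)
  next
    fix a b :: nat
    have "\<not> {1..m} \<subseteq> {a, b}"
      using card_mono[of "{a, b}" "{1..m}"] \<open>m \<ge> 3\<close> card_insert_le_m1[of 2 "{b}" a] by auto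
    then show "\<exists>u\<in>{..<n}. \<exists>v\<in>{..<n}. ?d u v \<noteq> a \<and> ?d u v \<noteq> b"
      unfolding img by auto
  qed
  \<comment> \<open>\<open>g\<close> assigns to each vertex of the single-colored side its color.
    All \<open>m\<close> colors occur among its \<open>n\<close> values, so the star at vertex 0 has
    enough leaves.\<close>
  then obtain g where g: "(\<forall>u<n. \<forall>v<n. ?d u v = g u) \<or> (\<forall>v<n. \<forall>u<n. ?d u v = g v)"
    unfolding lessThan_iff Ball_def by metis
  then have "{1..m} \<subseteq> g ` {..<n}"
    unfolding img by fastforce
  then have "card {1..m} \<le> card {..<n}"
    by (rule surj_card_le[rotated]) simp
  then have "m \<le> n" by simp
  with g \<open>m \<ge> 3\<close> show "\<exists>S\<in>copies H (complete_bipartite n n). monochromatic c S"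
    by (intro mono_star_copy[OF S, of n 0 c "g 0"]) auto
qed

text \<open>The Ramsey condition holds at every size, so only the existence of an exact coloring
  bounds \<open>N\<close> from below: \<open>N * N\<close> edges must carry \<open>t ^ 2 - 1\<close>
  colors.\<close>

lemma bgr_eq:
  assumes "t \<ge> 2" and S: "subgraph S (complete_bipartite 1 (t ^ 2 - 1))" "graph_iso S H"
  shows "bgr (t ^ 2 - 1) (path_graph 4) H = t"
  unfolding bgr_def
proof (rule Least_equality)
  have "t ^ 2 \<ge> 2 ^ 2" using assms(1) by (rule power_mono) simp
  then have "t ^ 2 - 1 \<ge> 3" by simp
  then show "(\<exists>c. exact_coloring (t ^ 2 - 1) (complete_bipartite t t) c) \<and>
    (\<forall>n\<ge>t. \<forall>c. exact_coloring (t ^ 2 - 1) (complete_bipartite n n) c \<longrightarrow>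
        (\<exists>S\<in>copies (path_graph 4) (complete_bipartite n n). rainbow c S) \<or>
        (\<exists>S\<in>copies H (complete_bipartite n n). monochromatic c S))"
    using ex_single_repeat_coloring[OF assms(1)] rainbow_P4_or_mono_star[OF _ _ S] by metis
next
  fix N
  assume "(\<exists>c. exact_coloring (t ^ 2 - 1) (complete_bipartite N N) c) \<and>
    (\<forall>n\<ge>N. \<forall>c. exact_coloring (t ^ 2 - 1) (complete_bipartite n n) c \<longrightarrow>
        (\<exists>S\<in>copies (path_graph 4) (complete_bipartite n n). rainbow c S) \<or>
        (\<exists>S\<in>copies H (complete_bipartite n n). monochromatic c S))"
  then obtain c where "c ` edges (complete_bipartite N N) = {1..t ^ 2 - 1}"
    by (auto simp: exact_coloring_def)
  then have "t ^ 2 - 1 \<le> N * N"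
    by (metis card_image_le card_atLeastAtMost diff_Suc_1 finite_edges_complete_bipartite
        card_edges_complete_bipartite)
  moreover have "N * N < t ^ 2 - 1" if "N < t"
  proof -
    \<comment> \<open>The square of \<open>t - 1\<close> falls short of \<open>t ^ 2\<close> by
      \<open>2 * t - 1\<close>, which exceeds 1 for \<open>t \<ge> 2\<close>.\<close>
    have "N * N \<le> (t - 1) * (t - 1)" using that by (intro mult_mono) auto
    moreover have "(t - 1) * (t - 1) + (2 * t - 1) = t ^ 2"
      using assms(1) by (cases t) (auto simp: power2_eq_square)
    ultimately show ?thesis using assms(1) by linarith
  qed
  ultimately show "t \<le> N" by linarith
qed

section \<open>The multiplicity: minimizing over exact colorings at size \<open>t\<close>\<close>

theorem theorem4p2:
  fixes k t :: nat and H :: "'a ugraph"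
  assumes "k = t ^ 2" and "k \<ge> 4"
    and "simple_graph H"
    and "\<exists>S. subgraph S (complete_bipartite 1 (k - 1)) \<and> graph_iso S H"
    and "card (edges H) \<ge> 3"
  shows "int (bi_GM (k - 1) (path_graph 4) H)
           = (int t)^2 * (int t - 1)^2 - 2 * (int t - 1)"
proof -
  have t: "t \<ge> 2"
  proof (rule ccontr)
    assume "\<not> t \<ge> 2"
    then have "t = 0 \<or> t = 1" by auto
    then show False using assms(1,2) by auto
  qed
  let ?K = "complete_bipartite t t"
  let ?num = "num_copies (path_graph 4) H ?K"
  let ?M = "(t * (t - 1)) ^ 2 - 2 * (t - 1)"
  have bgr: "bgr (k - 1) (path_graph 4) H = t"
    using assms(1,4) t bgr_eq by metis
  have "bi_GM (k - 1) (path_graph 4) H = ?M"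
    unfolding bi_GM_def bgr Let_def
  proof (rule Least_equality)
    \<comment> \<open>The repeated color sits on two adjacent edges, the position that spoils the
      most paths.\<close>
    obtain c where c: "exact_coloring (t ^ 2 - 1) ?K c" "c (bedge (0, 0)) = c (bedge (0, 1))"
      "inj_on c (edges ?K - {bedge (0, 0)})"
      using ex_single_repeat_coloring[OF t] .
    have "?num c + card (paths_through t (0, 0) (0, 1)) = (t * (t - 1)) ^ 2"
      using t by (intro num_copies_single_repeat[OF assms(5) _ _ _ c(2,3)]) auto
    then have "?num c = ?M"
      using t card_paths_through_adjacent(1)[of 0 t 0 1] by simp
    then show "\<exists>c. exact_coloring (k - 1) ?K c \<and> ?M = ?num c"
      using c(1) assms(1) by metis
  next
    fix m assume "\<exists>c. exact_coloring (k - 1) ?K c \<and> m = ?num c"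
    then obtain c where c: "c ` edges ?K = {1..t ^ 2 - 1}" and m: "m = ?num c"
      using assms(1) by (auto simp: exact_coloring_def)
    \<comment> \<open>There is one color fewer than edges, so every competing coloring has a single
      repeated pair.\<close>
    have "card (c ` edges ?K) + 1 = card (edges ?K)"
      unfolding c card_edges_complete_bipartite using t by (simp add: power2_eq_square)
    then obtain x y where xy: "x \<in> edges ?K" "y \<in> edges ?K" "x \<noteq> y" "c x = c y"
      "inj_on c (edges ?K - {x})"
      using single_repeat[of "edges ?K" c] by auto
    then obtain e f where ef: "e \<in> {..<t} \<times> {..<t}" "f \<in> {..<t} \<times> {..<t}" "x = bedge e" "y = bedge f"
      by (auto simp: edges_complete_bipartite)
    then have "e \<noteq> f" using xy(3) by auto
    have "m + card (paths_through t e f) = (t * (t - 1)) ^ 2"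
      unfolding m using num_copies_single_repeat[OF assms(5) ef(1,2) \<open>e \<noteq> f\<close>] xy ef by auto
    then show "?M \<le> m"
      using card_paths_through_le[OF ef(1,2) \<open>e \<noteq> f\<close>] by linarith
  qed
  \<comment> \<open>This makes the subtraction in \<open>?M\<close> genuine, so that it carries over
    to the integers.\<close>
  moreover have "2 * (t - 1) \<le> (t * (t - 1)) ^ 2"
  proof -
    have "2 * (t - 1) \<le> t * (t - 1)" using t by (intro mult_right_mono) auto
    also have "\<dots> \<le> (t * (t - 1)) ^ 2" by (simp only: power2_eq_square le_square)
    finally show ?thesis .
  qed
  ultimately show ?thesis
    using t by (simp add: of_nat_diff power_mult_distrib)
qed

end
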